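(* Let $\mathbf{B}\in\mathbb{R}^{n\times n}$ and $\mathbf{R}\in\mathbb{R}^{d\times d}$ be invertible covariance (symmetric positive definite) matrices, let $\mathbf{x}_b\in\mathbb{R}^n$, $\mathbf{y}\in\mathbb{R}^d$, and let $h:\mathbb{R}^n\to\mathbb{R}^d$ be a map. For $\mathbf{x}\in\mathbb{R}^n$ let $$J_b(\mathbf{x})=\tfrac12(\mathbf{x}-\mathbf{x}_b)^T\mathbf{B}^{-1}(\mathbf{x}-\mathbf{x}_b),\qquad J_o(\mathbf{x})=\tfrac12(\mathbf{y}-h[\mathbf{x}])^T\mathbf{R}^{-1}(\mathbf{y}-h[\mathbf{x}]),\qquad J=J_b+J_o.$$ Let $\alpha>0$, let $\mathbf{R}_{MVI}=\alpha^2\mathbf{R}$, and let $J_{MVI}$ be the function obtained from $J$ by replacing $\mathbf{R}$ with $\mathbf{R}_{MVI}$. Then for all $\mathbf{x}\in\mathbb{R}^n$, $$J_{MVI}(\mathbf{x})=J_b(\mathbf{x})+\frac{1}{\alpha^2}J_o(\mathbf{x}).$$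
   Context: $J$ is the 3D-Var data assimilation objective function, with background $\mathbf{x}_b$, observations $\mathbf{y}$, observation operator $h$, background error covariance $\mathbf{B}$ and observation error covariance $\mathbf{R}$. Multiplicative variance inflation with constant factor $\alpha>0$ multiplies all standard deviations of $\mathbf{R}$ by $\alpha$ and leaves correlations unchanged, i.e. it replaces $\mathbf{R}$ by $\mathbf{R}_{MVI}=\alpha^2\mathbf{R}$. *)

theory Defs
  imports "HOL-Analysis.Analysis"
begin

definition spd_matrix :: "real ^ 'n ^ 'n \<Rightarrow> bool" where
  "spd_matrix A \<longleftrightarrow> transpose A = A \<and> (\<forall>v. v \<noteq> 0 \<longrightarrow> v \<bullet> (A *v v) > 0)"

text \<open>Positive definiteness gives invertibility, so \<^const>\<open>matrix_inv\<close> is the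
  genuine inverse wherever it is applied to such a matrix.\<close>

lemma spd_matrix_invertible:
  assumes "spd_matrix A"
  shows "invertible A"
proof -
  have "v = 0" if "A *v v = 0" for v
    using assms that by (force simp: spd_matrix_def)
  then show ?thesis
    using matrix_left_invertible_ker invertible_left_inverse by blast
qed

definition J_b :: "real ^ 'n ^ 'n \<Rightarrow> real ^ 'n \<Rightarrow> real ^ 'n \<Rightarrow> real" where
  "J_b B x\<^sub>b x = 1 / 2 * ((x - x\<^sub>b) \<bullet> (matrix_inv B *v (x - x\<^sub>b)))"

definition J_o ::
    "real ^ 'd ^ 'd \<Rightarrow> real ^ 'd \<Rightarrow> (real ^ 'n \<Rightarrow> real ^ 'd) \<Rightarrow> real ^ 'n \<Rightarrow> real" where
  "J_o R y h x = 1 / 2 * ((y - h x) \<bullet> (matrix_inv R *v (y - h x)))"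

definition J ::
    "real ^ 'n ^ 'n \<Rightarrow> real ^ 'd ^ 'd \<Rightarrow> real ^ 'n \<Rightarrow> real ^ 'd \<Rightarrow>
     (real ^ 'n \<Rightarrow> real ^ 'd) \<Rightarrow> real ^ 'n \<Rightarrow> real" where
  "J B R x\<^sub>b y h x = J_b B x\<^sub>b x + J_o R y h x"

text \<open>Scaling every standard deviation by \<open>\<alpha>\<close> with the correlations fixed scales
  every covariance entry by \<open>\<alpha>\<^sup>2\<close>.\<close>

definition R_MVI :: "real \<Rightarrow> real ^ 'd ^ 'd \<Rightarrow> real ^ 'd ^ 'd" where
  "R_MVI \<alpha> R = \<alpha>\<^sup>2 *\<^sub>R R"

definition J_MVI ::
    "real \<Rightarrow> real ^ 'n ^ 'n \<Rightarrow> real ^ 'd ^ 'd \<Rightarrow> real ^ 'n \<Rightarrow> real ^ 'd \<Rightarrow>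
     (real ^ 'n \<Rightarrow> real ^ 'd) \<Rightarrow> real ^ 'n \<Rightarrow> real" where
  "J_MVI \<alpha> B R x\<^sub>b y h x = J B (R_MVI \<alpha> R) x\<^sub>b y h x"

end

theory Submission
  imports Defs
begin

text \<open>Quadratic forms are linear in their matrix and inversion turns a scalar factor into its
  reciprocal: \<open>(\<alpha>\<^sup>2 R)\<^sup>-\<^sup>1 = \<alpha>\<^sup>-\<^sup>2 R\<^sup>-\<^sup>1\<close>.  Inflation therefore
  scales the observation term by \<open>1 / \<alpha>\<^sup>2\<close> (lemma \<open>J_o_scaleR\<close>), and the background
  term, in which \<open>R\<close> does not occur, is unchanged.\<close>

text \<open>\<^const>\<open>matrix_inv\<close> is a choice among two-sided inverses.  For a square matrix over a field a
  right inverse is also a left inverse, and a two-sided inverse is unique, so one product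
  identifies the chosen matrix.\<close>

lemma matrix_inv_eqI:
  fixes A C :: "'a::field ^ 'n ^ 'n"
  assumes "A ** C = mat 1"
  shows "matrix_inv A = C"
proof -
  have CA: "C ** A = mat 1"
    using assms by (simp add: matrix_left_right_inverse)
  have inv: "matrix_inv A ** A = mat 1"
    unfolding matrix_inv_def using someI[of "\<lambda>C. A ** C = mat 1 \<and> C ** A = mat 1" C] assms CA
    by blast
  have "matrix_inv A = matrix_inv A ** (A ** C)"
    by (simp only: assms matrix_mul_rid)
  also have "\<dots> = C"
    by (simp only: matrix_mul_assoc inv matrix_mul_lid)
  finally show ?thesis .
qed

lemma matrix_inv_scaleR:
  fixes A :: "real ^ 'n ^ 'n"
  assumes "invertible A" and "c \<noteq> 0"
  shows "matrix_inv (c *\<^sub>R A) = (1 / c) *\<^sub>R matrix_inv A"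
proof (rule matrix_inv_eqI)
  obtain C where C: "A ** C = mat 1"
    using assms(1) unfolding invertible_def by blast
  then show "(c *\<^sub>R A) ** ((1 / c) *\<^sub>R matrix_inv A) = mat 1"
    using assms(2) by (simp add: matrix_inv_eqI[OF C] matrix_scalar_ac C)
qed

lemma J_o_scaleR:
  assumes "invertible R" and "c \<noteq> 0"
  shows "J_o (c *\<^sub>R R) y h x = 1 / c * J_o R y h x"
  by (simp only: J_o_def matrix_inv_scaleR[OF assms] scaleR_matrix_vector_assoc[symmetric]
      inner_scaleR_right mult.left_commute)

theorem theorem8:
  fixes B :: "real ^ 'n ^ 'n" and R :: "real ^ 'd ^ 'd"
    and x\<^sub>b :: "real ^ 'n" and y :: "real ^ 'd"
    and h :: "real ^ 'n \<Rightarrow> real ^ 'd" and \<alpha> :: real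
  assumes "spd_matrix B" and "spd_matrix R" and "\<alpha> > 0"
  shows "\<forall>x. J_MVI \<alpha> B R x\<^sub>b y h x = J_b B x\<^sub>b x + 1 / \<alpha>\<^sup>2 * J_o R y h x"
  using assms(3)
  by (simp add: J_MVI_def J_def R_MVI_def J_o_scaleR[OF spd_matrix_invertible[OF assms(2)]])

end
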